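(* Let $X\in S_n$ avoid at least one permutation of length $k$ (i.e. $X\in\mathcal{C}_k$). Then the cost of \textsc{SGreedy} on $X$ is at most $n\,2^{O(k)}$; this holds with an arbitrary initial tree $T$.
   Context: $X$ contains $\pi\in S_k$ if some length-$k$ subsequence of $X$ is order-isomorphic to $\pi$; otherwise $X$ avoids $\pi$. Geometric model: $X=(x_1,\dots,x_n)$ is identified with access points $\{(x_t,t)\}$ (key, time). $\square_{pq}$ is the closed axis-parallel rectangle with corners $p,q$. An initial tree $T$ (BST on $[n]$ of depth $d$, root depth 1) is represented by the points $(x,s)$, $s=1-d,\dots,1-d(x)$, for each key $x$ of depth $d(x)$ (empty if there is no initial tree). For an algorithm producing output row by row, let $\tau(b,t)$ be the largest time $\le t$ at which column $b$ contains a point of $T$ or of the output so far. At time $t$ with access $(a,t)$, the stair $\mathrm{stair}_t(a)$ is the set of keys $b\ne a$ with $\tau(b,t-1)$ defined such that $\square_{(a,t),(b,\tau(b,t-1))}$ contains no point of $T\cup\{$output points at times $<t\}$ other than $(b,\tau(b,t-1))$. \textsc{GreedyLeft} adds $(a,t)$ and $(b,t)$ for $b\in\mathrm{stair}_t(a)$, $b<a$; \textsc{GreedyRight} adds $(a,t)$ and $(b,t)$ for $b\in\mathrm{stair}_t(a)$, $b>a$ (each computed with respect to its own output). \textsc{SGreedy} outputs the union of the \textsc{GreedyLeft} and \textsc{GreedyRight} outputs; its cost is the size of this union. *)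

theory Defs
  imports Complex_Main "HOL-Combinatorics.Permutations" "HOL-Library.Tree"
begin

text \<open>A sequence $X \in S_n$ is a function \<open>X\<close> with \<open>X permutes {1..n}\<close>; \<open>X t\<close> is the
  key accessed at time \<open>t\<close>.\<close>

definition contains_pattern :: "nat \<Rightarrow> (nat \<Rightarrow> nat) \<Rightarrow> nat \<Rightarrow> (nat \<Rightarrow> nat) \<Rightarrow> bool" where
  "contains_pattern n X k \<pi> \<longleftrightarrow>
     (\<exists>f. strict_mono_on {1..k} f \<and> f ` {1..k} \<subseteq> {1..n} \<and>
          (\<forall>i\<in>{1..k}. \<forall>j\<in>{1..k}. X (f i) < X (f j) \<longleftrightarrow> \<pi> i < \<pi> j))"

abbreviation avoids_pattern :: "nat \<Rightarrow> (nat \<Rightarrow> nat) \<Rightarrow> nat \<Rightarrow> (nat \<Rightarrow> nat) \<Rightarrow> bool" where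
  "avoids_pattern n X k \<pi> \<equiv> \<not> contains_pattern n X k \<pi>"

text \<open>Points are pairs (key, time). Times are integers because an initial tree occupies
  nonpositive times.\<close>

type_synonym point = "nat \<times> int"

definition rect :: "point \<Rightarrow> point \<Rightarrow> point set" where
  "rect p q = {min (fst p) (fst q)..max (fst p) (fst q)} \<times> {min (snd p) (snd q)..max (snd p) (snd q)}"

text \<open>Depth of a key of a search tree, the root having depth 1, so that \<open>height\<close> is the depth of the
  tree. The value for a key that does not occur is irrelevant.\<close>

fun key_depth :: "nat tree \<Rightarrow> nat \<Rightarrow> nat" where
  "key_depth Leaf x = 0"
| "key_depth (Node l a r) x =
     (if x = a then 1 else if x < a then Suc (key_depth l x) else Suc (key_depth r x))"

definition tree_points :: "nat tree \<Rightarrow> point set" where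
  "tree_points T =
     {(x, s). x \<in> set_tree T \<and> 1 - int (height T) \<le> s \<and> s \<le> 1 - int (key_depth T x)}"

text \<open>\<open>None\<close> stands for the absence of an initial tree.\<close>

definition is_initial_tree :: "nat \<Rightarrow> nat tree option \<Rightarrow> bool" where
  "is_initial_tree n T \<longleftrightarrow> (case T of None \<Rightarrow> True | Some t \<Rightarrow> bst t \<and> set_tree t = {1..n})"

definition initial_points :: "nat tree option \<Rightarrow> point set" where
  "initial_points T = (case T of None \<Rightarrow> {} | Some t \<Rightarrow> tree_points t)"

text \<open>\<open>P\<close> is the set of the points of the initial tree and of the output so far.
  \<open>last_touch P b t\<close> is $\tau(b,t)$; it is defined iff \<open>touched P b t\<close> holds.\<close>

definition touched :: "point set \<Rightarrow> nat \<Rightarrow> int \<Rightarrow> bool" where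
  "touched P b t \<longleftrightarrow> (\<exists>s\<le>t. (b, s) \<in> P)"

definition last_touch :: "point set \<Rightarrow> nat \<Rightarrow> int \<Rightarrow> int" where
  "last_touch P b t = Max {s. s \<le> t \<and> (b, s) \<in> P}"

definition stair :: "point set \<Rightarrow> int \<Rightarrow> nat \<Rightarrow> nat set" where
  "stair P t a =
     {b. b \<noteq> a \<and> touched P b (t - 1) \<and>
         rect (a, t) (b, last_touch P b (t - 1)) \<inter> P \<subseteq> {(b, last_touch P b (t - 1))}}"

text \<open>Output up to and including time \<open>t\<close>, where \<open>I\<close> is the set of points of the initial tree.\<close>

fun greedy_left :: "point set \<Rightarrow> (nat \<Rightarrow> nat) \<Rightarrow> nat \<Rightarrow> point set" where
  "greedy_left I X 0 = {}"
| "greedy_left I X (Suc t) =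
     greedy_left I X t \<union> {(X (Suc t), int (Suc t))} \<union>
     {(b, int (Suc t)) | b.
        b \<in> stair (I \<union> greedy_left I X t) (int (Suc t)) (X (Suc t)) \<and> b < X (Suc t)}"

fun greedy_right :: "point set \<Rightarrow> (nat \<Rightarrow> nat) \<Rightarrow> nat \<Rightarrow> point set" where
  "greedy_right I X 0 = {}"
| "greedy_right I X (Suc t) =
     greedy_right I X t \<union> {(X (Suc t), int (Suc t))} \<union>
     {(b, int (Suc t)) | b.
        b \<in> stair (I \<union> greedy_right I X t) (int (Suc t)) (X (Suc t)) \<and> b > X (Suc t)}"

definition sgreedy :: "nat tree option \<Rightarrow> nat \<Rightarrow> (nat \<Rightarrow> nat) \<Rightarrow> point set" where
  "sgreedy T n X = greedy_left (initial_points T) X n \<union> greedy_right (initial_points T) X n"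

definition sgreedy_cost :: "nat tree option \<Rightarrow> nat \<Rightarrow> (nat \<Rightarrow> nat) \<Rightarrow> nat" where
  "sgreedy_cost T n X = card (sgreedy T n X)"

text \<open>The sets under \<open>Max\<close> and \<open>card\<close> above are finite.\<close>

lemma finite_stair: "finite P \<Longrightarrow> finite (stair P t a)"
  by (rule finite_subset[of _ "fst ` P"]) (force simp: stair_def touched_def)+

lemma finite_greedy_left: "finite I \<Longrightarrow> finite (greedy_left I X t)"
  by (induction t) (auto simp: finite_stair)

lemma finite_greedy_right: "finite I \<Longrightarrow> finite (greedy_right I X t)"
  by (induction t) (auto simp: finite_stair)

lemma finite_initial_points: "finite (initial_points T)"
proof -
  have "finite (tree_points t)" for t
    by (rule finite_subset[of _ "set_tree t \<times> {1 - int (height t)..1}"])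
       (auto simp: tree_points_def)
  then show ?thesis by (simp add: initial_points_def split: option.split)
qed

lemma finite_sgreedy: "finite (sgreedy T n X)"
  by (simp add: sgreedy_def finite_greedy_left finite_greedy_right finite_initial_points)

end

theory Submission
  imports Defs
begin

text \<open>
  In the output of \<open>GreedyRight\<close>, the bounding box of two points \<open>(x, s)\<close> and \<open>(y, t)\<close> with
  \<open>x < y\<close> and \<open>s < t\<close> contains an access: otherwise \<open>y\<close> is touched at time \<open>t\<close> by an access left of
  \<open>x\<close>, and then \<open>(x, s)\<close> blocks the stair unless \<open>y\<close> was already touched strictly between \<open>s\<close> and \<open>t\<close>;
  descend. So if every point of \<open>\<pi>\<close> is replaced by an increasing pair and the output contains the
  result, the input contains \<open>\<pi>\<close>; \<open>GreedyLeft\<close> is the mirror image.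

  It remains to bound by \<open>n 2\<^sup>O\<^sup>(\<^sup>k\<^sup>)\<close> the number of ones of a matrix that avoids a permutation matrix of
  order \<open>O(k)\<close>. Following Fox, one bounds the number of ones of a matrix without an all-ones
  interval minor of order \<open>k\<close>, by a block recursion as in the proof of Marcus and Tardos: with
  blocks of side \<open>2 \<sqdot> 4\<^sup>k\<close>, at most \<open>2\<^sup>O\<^sup>(\<^sup>k\<^sup>)\<close> blocks in each column of blocks have \<open>2\<^sup>k\<close> nonzero columns,
  likewise for rows, and every other block has at most \<open>4\<^sup>k\<close> ones.
\<close>

section \<open>All-ones interval minors\<close>

text \<open>The monotone maps \<open>u\<close> and \<open>v\<close> label each row and column with its block.\<close>

definition full_minor :: "nat \<Rightarrow> nat \<Rightarrow> (nat \<times> nat) set \<Rightarrow> bool" where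
  "full_minor r c A \<longleftrightarrow>
     (\<exists>u v. mono u \<and> mono v \<and> {..<r} \<times> {..<c} \<subseteq> map_prod u v ` A)"

lemma full_minorI:
  assumes "mono u" "mono v"
    and "\<And>i j. i < r \<Longrightarrow> j < c \<Longrightarrow> \<exists>x y. (x, y) \<in> A \<and> u x = i \<and> v y = j"
  shows "full_minor r c A"
  unfolding full_minor_def
proof (intro exI conjI subsetI)
  fix p assume "p \<in> {..<r} \<times> {..<c}"
  then obtain i j where "p = (i, j)" "i < r" "j < c" by auto
  with assms(3) show "p \<in> map_prod u v ` A" by (force simp: image_iff)
qed (use assms in auto)

lemma full_minorE:
  assumes "full_minor r c A"
  obtains u v where "mono u" "mono v"
    and "\<And>i j. i < r \<Longrightarrow> j < c \<Longrightarrow> \<exists>x y. (x, y) \<in> A \<and> u x = i \<and> v y = j"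
proof -
  obtain u v where uv: "mono u" "mono v" "{..<r} \<times> {..<c} \<subseteq> map_prod u v ` A"
    using assms by (auto simp: full_minor_def)
  have "\<exists>x y. (x, y) \<in> A \<and> u x = i \<and> v y = j" if "i < r" "j < c" for i j
    using uv(3) that by (force simp: subset_iff image_iff)
  with uv show thesis using that by blast
qed

section \<open>Operations on minors: restriction, contraction, transposition, adding a
  column\<close>

lemma full_minor_mono: "full_minor r c A \<Longrightarrow> A \<subseteq> B \<Longrightarrow> full_minor r c B"
  by (force simp: full_minor_def)

text \<open>Block labels of the contracted matrix, composed with \<open>g\<close> and
  \<open>h\<close>, are block labels of \<open>A\<close>. So contracting never creates a
  minor.\<close>

lemma full_minor_contract:
  assumes "full_minor r c (map_prod g h ` A)" "mono g" "mono h"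
  shows "full_minor r c A"
proof -
  obtain u v where uv: "mono u" "mono v" "{..<r} \<times> {..<c} \<subseteq> map_prod u v ` map_prod g h ` A"
    using assms by (auto simp: full_minor_def)
  have "mono (u \<circ> g)" "mono (v \<circ> h)"
    using assms uv by (auto intro: mono_compose simp: mono_def)
  moreover have "{..<r} \<times> {..<c} \<subseteq> map_prod (u \<circ> g) (v \<circ> h) ` A"
    using uv(3) by (simp add: image_image map_prod.comp flip: map_prod.comp image_comp)
  ultimately show ?thesis unfolding full_minor_def by blast
qed

lemma full_minor_swap: "full_minor r c (prod.swap ` A) \<Longrightarrow> full_minor c r A"
  by (elim full_minorE, rule full_minorI) (fastforce+)

lemma full_minor_single_column:
  assumes "finite R" "r \<le> card R" "\<And>x. x \<in> R \<Longrightarrow> card {y. (x, y) \<in> A} \<noteq> 0"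
  shows "full_minor r 1 A"
proof -
  \<comment> \<open>The rank relative to \<open>R\<close>: monotone on all row indices, and a
    bijection from \<open>R\<close> onto \<open>{..<card R}\<close>. Every row of \<open>R\<close>
    thus gets a block of its own.\<close>
  define u where "u x = card {z \<in> R. z < x}" for x
  have mono_u: "mono u"
    unfolding u_def using assms(1) by (intro monoI card_mono) auto
  have "inj_on u R"
  proof (rule linorder_inj_onI)
    fix x y assume "x < y" "x \<in> R" "y \<in> R"
    then have "{z \<in> R. z < x} \<subset> {z \<in> R. z < y}" by auto
    then have "u x < u y" unfolding u_def using assms(1) by (intro psubset_card_mono) auto
    then show "u x \<noteq> u y" by simp
  qed auto
  moreover have "u ` R \<subseteq> {..<card R}"
  proof
    fix i assume "i \<in> u ` R"
    then obtain x where "x \<in> R" "i = u x" by auto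
    moreover from \<open>x \<in> R\<close> have "{z \<in> R. z < x} \<subset> R" by auto
    ultimately show "i \<in> {..<card R}"
      unfolding u_def using assms(1) by (auto intro: psubset_card_mono)
  qed
  ultimately have "u ` R = {..<card R}"
    by (intro card_subset_eq) (auto simp: card_image)
  show ?thesis
  proof (rule full_minorI[OF mono_u, of "\<lambda>_. 0"])
    fix i j :: nat assume "i < r" "j < 1"
    then have "i \<in> u ` R" using \<open>u ` R = _\<close> assms(2) by auto
    then obtain x where "x \<in> R" "u x = i" by auto
    moreover then obtain y where "(x, y) \<in> A" using assms(3)[of x] by fastforce
    ultimately show "\<exists>x y. (x, y) \<in> A \<and> u x = i \<and> 0 = j"
      using \<open>j < 1\<close> by auto
  qed (simp add: mono_def)
qed

text \<open>Merging all columns from \<open>m\<close> on into one block adds a full column, because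
  each row that meets \<open>A\<close> has a one there. As \<open>c \<ge> 1\<close>, each row block
  contains a row that meets \<open>A\<close>.\<close>

lemma full_minor_add_right_column:
  assumes "full_minor r c A" "c \<ge> 1" "\<And>x y. (x, y) \<in> A \<Longrightarrow> y < m"
    and "A \<subseteq> B" "\<And>x. x \<in> fst ` A \<Longrightarrow> \<exists>y\<ge>m. (x, y) \<in> B"
  shows "full_minor r (Suc c) B"
proof -
  obtain u v where u: "mono u" and v: "mono v"
    and uv: "\<And>i j. i < r \<Longrightarrow> j < c \<Longrightarrow> \<exists>x y. (x, y) \<in> A \<and> u x = i \<and> v y = j"
    using full_minorE[OF assms(1)] by blast
  \<comment> \<open>Left of \<open>m\<close>, the map \<open>v\<close> may reach \<open>c\<close> or
    more. The cut-off at \<open>c - 1\<close> keeps \<open>v'\<close> monotone and preserves the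
    labels below \<open>c\<close>.\<close>
  define v' where "v' y = (if y < m then min (v y) (c - 1) else c)" for y
  have "mono v'"
    using v by (auto simp: v'_def mono_def min_def le_diff_conv intro: le_trans)
  then show ?thesis
  proof (rule full_minorI[OF u])
    fix i j assume i: "i < r" and j: "j < Suc c"
    show "\<exists>x y. (x, y) \<in> B \<and> u x = i \<and> v' y = j"
    proof (cases "j = c")
      case True
      obtain x y where "(x, y) \<in> A" "u x = i" using uv[of i 0] i assms(2) by auto
      moreover then obtain y' where "y' \<ge> m" "(x, y') \<in> B" using assms(5)[of x] by force
      moreover then have "v' y' = j" using True by (simp add: v'_def)
      ultimately show ?thesis by blast
    next
      case False
      then obtain x y where "(x, y) \<in> A" "u x = i" "v y = j" using uv[of i j] i j by auto
      moreover have "v' y = j" using calculation False j assms(3)[of x y] by (auto simp: v'_def)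
      ultimately show ?thesis using assms(4) by blast
    qed
  qed
qed

lemma full_minor_add_left_column:
  assumes "full_minor r c A" "c \<ge> 1" "\<And>x y. (x, y) \<in> A \<Longrightarrow> y \<ge> m"
    and "A \<subseteq> B" "\<And>x. x \<in> fst ` A \<Longrightarrow> \<exists>y<m. (x, y) \<in> B"
  shows "full_minor r (Suc c) B"
proof -
  obtain u v where u: "mono u" and v: "mono v"
    and uv: "\<And>i j. i < r \<Longrightarrow> j < c \<Longrightarrow> \<exists>x y. (x, y) \<in> A \<and> u x = i \<and> v y = j"
    using full_minorE[OF assms(1)] by blast
  \<comment> \<open>The new block takes label 0 and the old labels move up by one, so no cut-off is
    needed here.\<close>
  define v' where "v' y = (if y < m then 0 else Suc (v y))" for y
  have "mono v'" using v by (auto simp: v'_def mono_def)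
  then show ?thesis
  proof (rule full_minorI[OF u])
    fix i j assume i: "i < r" and j: "j < Suc c"
    show "\<exists>x y. (x, y) \<in> B \<and> u x = i \<and> v' y = j"
    proof (cases j)
      case 0
      obtain x y where "(x, y) \<in> A" "u x = i" using uv[of i 0] i assms(2) by auto
      moreover then obtain y' where "y' < m" "(x, y') \<in> B" using assms(5)[of x] by force
      moreover then have "v' y' = j" using 0 by (simp add: v'_def)
      ultimately show ?thesis by blast
    next
      case (Suc j')
      then obtain x y where "(x, y) \<in> A" "u x = i" "v y = j'" using uv[of i j'] i j by auto
      moreover have "v' y = j" using calculation Suc assms(3)[of x y] by (auto simp: v'_def)
      ultimately show ?thesis using assms(4) by blast
    qed
  qed
qed

text \<open>Halve the column range: a row with ones in both halves has half of its ones in one of them, and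
  the other half then supplies one column of the minor.\<close>

lemma card_dense_rows_le:
  assumes "finite R" "1 \<le> c" "c \<le> Suc b" "A \<subseteq> UNIV \<times> {lo..<lo + 2 ^ m}"
    and "\<And>x. x \<in> R \<Longrightarrow> 2 ^ b \<le> card {y. (x, y) \<in> A}"
    and "\<not> full_minor r c A"
  shows "card R \<le> r * 4 ^ m"
  using assms
proof (induction m arbitrary: R c b A lo)
  case (0 R c b A lo)
  show ?case
  proof (cases "c = 1")
    case True
    have "card {y. (x, y) \<in> A} \<noteq> 0" if "x \<in> R" for x
      using "0.prems"(5)[OF that] by (metis le_zero_eq power_eq_0_iff zero_neq_numeral)
    then have "\<not> r \<le> card R"
      using full_minor_single_column "0.prems"(1,6) True by blast
    then show ?thesis by simp
  next
    case False
    \<comment> \<open>With \<open>c \<ge> 2\<close> and \<open>c \<le> Suc b\<close>, a row of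
      \<open>R\<close> needs at least two ones, but the range has width one.\<close>
    have "R = {}"
    proof (rule ccontr)
      assume "R \<noteq> {}"
      then obtain x where x: "x \<in> R" by auto
      have "{y. (x, y) \<in> A} \<subseteq> {lo}" using "0.prems"(4) by auto
      from card_mono[OF _ this] have "2 ^ b \<le> (1::nat)" using "0.prems"(5)[OF x] by simp
      moreover have "b \<noteq> 0" using False "0.prems"(2,3) by simp
      ultimately show False
        by (metis One_nat_def one_less_numeral_iff one_less_power linorder_not_le neq0_conv semiring_norm(76))
    qed
    then show ?thesis by simp
  qed
next
  case (Suc m R c b A lo)
  show ?case
  proof (cases "c = 1")
    case True
    have "card {y. (x, y) \<in> A} \<noteq> 0" if "x \<in> R" for x
      using Suc.prems(5)[OF that] by (metis le_zero_eq power_eq_0_iff zero_neq_numeral)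
    then have "\<not> r \<le> card R"
      using full_minor_single_column Suc.prems(1,6) True by blast
    then have "card R \<le> r * 1" by simp
    also have "\<dots> \<le> r * 4 ^ Suc m" by (intro mult_left_mono) auto
    finally show ?thesis .
  next
    case False
    define mid where "mid = lo + 2 ^ m"
    obtain c' where c': "c = Suc c'" "c' \<ge> 1" using False Suc.prems(2) by (cases c) auto
    obtain b' where b': "b = Suc b'" using c' Suc.prems(3) by (cases b) auto
    define L where "L x = {y. (x, y) \<in> A \<and> y < mid}" for x
    define H where "H x = {y. (x, y) \<in> A \<and> mid \<le> y}" for x
    have fin: "finite (L x)" "finite (H x)" for x
      by (rule finite_subset[of _ "{lo..<lo + 2 ^ Suc m}"]; use Suc.prems(4) in \<open>auto simp: L_def H_def\<close>)+
    have split: "{y. (x, y) \<in> A} = L x \<union> H x" "L x \<inter> H x = {}" for x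
      by (auto simp: L_def H_def)
    have sum: "2 ^ b \<le> card (L x) + card (H x)" if "x \<in> R" for x
      using Suc.prems(5)[OF that] card_Un_disjoint[OF fin(1) fin(2) split(2), of x]
      by (simp add: split)
    \<comment> \<open>Rows in \<open>R1\<close> and \<open>R2\<close> have all ones in one half, and
      induction applies with \<open>c\<close> and \<open>b\<close> unchanged. Rows in
      \<open>R3\<close> and \<open>R4\<close> have a dense half and a nonempty other half; there
      \<open>c\<close> and \<open>b\<close> both drop by one, which preserves
      \<open>c \<le> Suc b\<close>. Four classes of size at most \<open>r * 4 ^ m\<close> give the
      factor 4 per halving.\<close>
    define R1 where "R1 = {x \<in> R. H x = {}}"
    define R2 where "R2 = {x \<in> R. L x = {}}"
    define R3 where "R3 = {x \<in> R. H x \<noteq> {} \<and> 2 ^ b' \<le> card (L x)}"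
    define R4 where "R4 = {x \<in> R. L x \<noteq> {} \<and> 2 ^ b' \<le> card (H x)}"
    have "R \<subseteq> R1 \<union> R2 \<union> (R3 \<union> R4)"
    proof
      fix x assume "x \<in> R"
      with sum[of x] have "2 ^ b' \<le> card (L x) \<or> 2 ^ b' \<le> card (H x)" by (auto simp: b')
      with \<open>x \<in> R\<close> show "x \<in> R1 \<union> R2 \<union> (R3 \<union> R4)" by (auto simp: R1_def R2_def R3_def R4_def)
    qed
    moreover have finR: "finite R1" "finite R2" "finite R3" "finite R4"
      using Suc.prems(1) by (auto simp: R1_def R2_def R3_def R4_def)
    ultimately have "card R \<le> card (R1 \<union> R2 \<union> (R3 \<union> R4))" by (intro card_mono) auto
    also have "\<dots> \<le> (card R1 + card R2) + (card R3 + card R4)"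
      by (meson add_mono card_Un_le le_trans)
    also have "\<dots> \<le> (r * 4 ^ m + r * 4 ^ m) + (r * 4 ^ m + r * 4 ^ m)"
    proof (intro add_mono)
      define AL where "AL = {(x, y) \<in> A. y < mid}"
      define AH where "AH = {(x, y) \<in> A. mid \<le> y}"
      have sub: "AL \<subseteq> UNIV \<times> {lo..<lo + 2 ^ m}" "AH \<subseteq> UNIV \<times> {mid..<mid + 2 ^ m}"
        using Suc.prems(4) by (auto simp: AL_def AH_def mid_def)
      have sec: "{y. (x, y) \<in> AL} = L x" "{y. (x, y) \<in> AH} = H x" for x
        by (auto simp: AL_def AH_def L_def H_def)
      have noAL: "\<not> full_minor r c AL" and noAH: "\<not> full_minor r c AH"
        using Suc.prems(6) full_minor_mono by (auto simp: AL_def AH_def)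
      show "card R1 \<le> r * 4 ^ m"
        by (rule Suc.IH[OF finR(1) Suc.prems(2,3) sub(1) _ noAL])
           (use sum in \<open>force simp: sec R1_def\<close>)
      show "card R2 \<le> r * 4 ^ m"
        by (rule Suc.IH[OF finR(2) Suc.prems(2,3) sub(2) _ noAH])
           (use sum in \<open>force simp: sec R2_def\<close>)
      have "c' \<le> Suc b'" using c' b' Suc.prems(3) by simp
      note IH = Suc.IH[OF _ c'(2) this]
      \<comment> \<open>Restricting to rows that also meet the other half keeps all ones of the
        dense half in rows of \<open>R3\<close> and \<open>R4\<close>, and lets any minor found be
        extended by a column.\<close>
      define AL' where "AL' = {(x, y) \<in> AL. H x \<noteq> {}}"
      define AH' where "AH' = {(x, y) \<in> AH. L x \<noteq> {}}"
      show "card R3 \<le> r * 4 ^ m"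
      proof (rule IH[OF finR(3), of AL' lo])
        show "AL' \<subseteq> UNIV \<times> {lo..<lo + 2 ^ m}" using sub(1) by (auto simp: AL'_def)
        show "2 ^ b' \<le> card {y. (x, y) \<in> AL'}" if "x \<in> R3" for x
          using that by (auto simp: AL'_def R3_def sec)
        show "\<not> full_minor r c' AL'"
        proof
          assume "full_minor r c' AL'"
          then have "full_minor r (Suc c') A"
            by (rule full_minor_add_right_column[where m = mid])
               (use c' in \<open>auto simp: AL'_def AL_def H_def\<close>)
          then show False using Suc.prems(6) c' by simp
        qed
      qed
      show "card R4 \<le> r * 4 ^ m"
      proof (rule IH[OF finR(4), of AH' mid])
        show "AH' \<subseteq> UNIV \<times> {mid..<mid + 2 ^ m}" using sub(2) by (auto simp: AH'_def)
        show "2 ^ b' \<le> card {y. (x, y) \<in> AH'}" if "x \<in> R4" for x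
          using that by (auto simp: AH'_def R4_def sec)
        show "\<not> full_minor r c' AH'"
        proof
          assume "full_minor r c' AH'"
          then have "full_minor r (Suc c') A"
            by (rule full_minor_add_left_column[where m = mid])
               (use c' in \<open>auto simp: AH'_def AH_def L_def\<close>)
          then show False using Suc.prems(6) c' by simp
        qed
      qed
    qed
    also have "\<dots> = r * 4 ^ Suc m" by simp
    finally show ?thesis .
  qed
qed

section \<open>The block recursion\<close>

definition wide_blocks :: "nat \<Rightarrow> nat \<Rightarrow> (nat \<times> nat) set \<Rightarrow> (nat \<times> nat) set" where
  "wide_blocks t s A = {(p, q). s \<le> card {y. y div t = q \<and> (\<exists>x. (x, y) \<in> A \<and> x div t = p)}}"

lemma mono_div: "mono (\<lambda>x::nat. x div t)"
  by (simp add: mono_def div_le_mono)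

lemma div_fiber_subset:
  assumes "t > 0"
  shows "{y::nat. y div t = q} \<subseteq> {q * t..<q * t + t}"
proof
  fix y assume "y \<in> {y. y div t = q}"
  then show "y \<in> {q * t..<q * t + t}"
    using div_mult_mod_eq[of y t] mod_less_divisor[OF assms, of y] by auto
qed

text \<open>Contract the rows to blocks but keep the columns of block column \<open>q\<close> apart.
  A wide block becomes a single row with at least \<open>2 ^ k\<close> ones in a range of length
  \<open>2 ^ (2 * k + 1)\<close>, so \<open>card_dense_rows_le\<close> counts the wide
  blocks.\<close>

lemma card_wide_blocks_column_le:
  fixes k :: nat
  defines "t \<equiv> 2 ^ (2 * k + 1)"
  assumes "k \<ge> 1" "\<not> full_minor k k A"
  shows "card {p. p < N \<and> (p, q) \<in> wide_blocks t (2 ^ k) A} \<le> k * 4 ^ (2 * k + 1)"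
proof -
  define A' where "A' = {(x, y) \<in> A. y div t = q}"
  define B where "B = map_prod (\<lambda>x. x div t) (\<lambda>y. y) ` A'"
  have t: "t > 0" by (simp add: t_def)
  show ?thesis
  proof (rule card_dense_rows_le[of _ k k B "q * t"])
    show "B \<subseteq> UNIV \<times> {q * t..<q * t + 2 ^ (2 * k + 1)}"
      using div_fiber_subset[OF t, of q] unfolding B_def A'_def t_def by fastforce
    show "2 ^ k \<le> card {y. (p, y) \<in> B}"
      if "p \<in> {p. p < N \<and> (p, q) \<in> wide_blocks t (2 ^ k) A}" for p
    proof -
      have "{y. (p, y) \<in> B} = {y. y div t = q \<and> (\<exists>x. (x, y) \<in> A \<and> x div t = p)}"
        by (force simp: B_def A'_def)
      then show ?thesis using that by (simp add: wide_blocks_def)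
    qed
    show "\<not> full_minor k k B"
    proof
      assume "full_minor k k B"
      then have "full_minor k k A'"
        unfolding B_def by (rule full_minor_contract) (simp_all add: mono_div mono_def div_le_mono)
      then have "full_minor k k A" by (rule full_minor_mono) (auto simp: A'_def)
      with assms show False by simp
    qed
  qed (use assms in auto)
qed

lemma card_wide_blocks_le:
  fixes k :: nat
  defines "t \<equiv> 2 ^ (2 * k + 1)"
  assumes "k \<ge> 1" "\<not> full_minor k k A"
  shows "card (wide_blocks t (2 ^ k) A \<inter> {..<N} \<times> {..<N}) \<le> N * (k * 4 ^ (2 * k + 1))"
proof -
  let ?S = "\<lambda>q. {p. p < N \<and> (p, q) \<in> wide_blocks t (2 ^ k) A}"
  have "wide_blocks t (2 ^ k) A \<inter> {..<N} \<times> {..<N} = prod.swap ` (SIGMA q:{..<N}. ?S q)"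
    by force
  then have "card (wide_blocks t (2 ^ k) A \<inter> {..<N} \<times> {..<N}) = card (SIGMA q:{..<N}. ?S q)"
    by (simp add: card_image)
  also have "\<dots> = (\<Sum>q<N. card (?S q))" by (subst card_SigmaI) auto
  also have "\<dots> \<le> (\<Sum>q<N. k * 4 ^ (2 * k + 1))"
    using card_wide_blocks_column_le[OF assms(2,3)] by (intro sum_mono) (simp add: t_def)
  finally show ?thesis by simp
qed

text \<open>Contracting blocks of side \<open>t\<close> gives a matrix of side \<open>t ^ j\<close>
  that still has no minor, so the induction hypothesis bounds the nonzero blocks. Blocks that are
  wide in either direction are few and may be counted as full.\<close>

lemma card_no_full_minor_power_le:
  fixes k :: nat
  defines "t \<equiv> 2 ^ (2 * k + 1)"
  assumes "k \<ge> 1" "\<not> full_minor k k A" "A \<subseteq> {..<t ^ j} \<times> {..<t ^ j}"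
  shows "card A \<le> 8 * 4 ^ k * k * 4 ^ (2 * k + 1) * t ^ j"
  using assms(3,4)
proof (induction j arbitrary: A)
  case (0 A)
  then have "A \<subseteq> {(0, 0)}" by auto
  from card_mono[OF _ this] have "card A \<le> 1" by simp
  also have "1 \<le> 8 * 4 ^ k * k * 4 ^ (2 * k + 1) * t ^ 0"
    using assms(2) by (simp add: Suc_le_eq)
  finally show ?case .
next
  case (Suc j A)
  define N where "N = t ^ j"
  define s :: nat where "s = 2 ^ k"
  define F where "F = k * 4 ^ (2 * k + 1)"
  \<comment> \<open>Chosen to close the recursion: the two exceptional terms sum to
    \<open>2 * t ^ 2 * N * F = 8 * s ^ 4 * N * F = s ^ 2 * D * N\<close>, equal to the term for
    ordinary blocks. Together they make \<open>2 * s ^ 2 * D * N = D * t * N\<close>.\<close>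
  define D where "D = 8 * 4 ^ k * F"
  have t: "t = 2 * s ^ 2" by (simp add: t_def s_def power_mult[symmetric] mult.commute)
  have s4: "s ^ 2 = 4 ^ k" by (simp add: s_def power2_eq_square flip: power_mult_distrib)
  define h where "h = map_prod (\<lambda>x. x div t) (\<lambda>y::nat. y div t)"
  define B where "B = h ` A"
  define W where "W = wide_blocks t s A \<inter> {..<N} \<times> {..<N}"
  define W' where "W' = wide_blocks t s (prod.swap ` A) \<inter> {..<N} \<times> {..<N}"
  have tpos: "t > 0" by (simp add: t_def)
  have finA: "finite A" using Suc.prems(2) finite_subset by blast
  have BN: "B \<subseteq> {..<N} \<times> {..<N}"
    using Suc.prems(2) tpos by (auto simp: B_def h_def N_def less_mult_imp_div_less mult.commute)
  have "\<not> full_minor k k B"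
  proof
    assume "full_minor k k B"
    then have "full_minor k k A"
      unfolding B_def h_def by (rule full_minor_contract) (simp_all add: mono_div)
    with Suc.prems(1) show False by simp
  qed
  then have cardB: "card B \<le> D * N"
    using Suc.IH[of B] BN by (simp add: N_def D_def F_def mult.assoc)
  have cardW: "card W \<le> N * F"
    using card_wide_blocks_le[OF assms(2) Suc.prems(1)] by (simp add: W_def F_def s_def t_def)
  have "\<not> full_minor k k (prod.swap ` A)" using Suc.prems(1) full_minor_swap by blast
  then have cardW': "card W' \<le> N * F"
    using card_wide_blocks_le[OF assms(2)] by (simp add: W'_def F_def s_def t_def)
  have finW: "finite W" "finite W'" by (simp_all add: W_def W'_def)
  \<comment> \<open>The ones of a block lie in the product of its nonzero rows and nonzero columns.
    This is at most \<open>s\<close> by \<open>s\<close> unless the block is exceptional.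
    \<open>W'\<close> comes from the transpose, hence the swapped index.\<close>
  have blk: "card {a \<in> A. h a = \<beta>} \<le> s ^ 2 + (if \<beta> \<in> W then t ^ 2 else 0) + (if prod.swap \<beta> \<in> W' then t ^ 2 else 0)"
    if "\<beta> \<in> B" for \<beta>
  proof -
    obtain p q where \<beta>: "\<beta> = (p, q)" by (cases \<beta>)
    have pq: "p < N" "q < N" using that BN \<beta> by auto
    define Ys where "Ys = {y. y div t = q \<and> (\<exists>x. (x, y) \<in> A \<and> x div t = p)}"
    define Xs where "Xs = {x. x div t = p \<and> (\<exists>y. (x, y) \<in> A \<and> y div t = q)}"
    have XsI: "Xs \<subseteq> {p * t..<p * t + t}" and YsI: "Ys \<subseteq> {q * t..<q * t + t}"
      using div_fiber_subset[OF tpos] by (fastforce simp: Xs_def Ys_def)+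
    have fin: "finite Xs" "finite Ys" using XsI YsI finite_subset by blast+
    have "{a \<in> A. h a = \<beta>} \<subseteq> Xs \<times> Ys" by (auto simp: \<beta> h_def Xs_def Ys_def)
    then have le: "card {a \<in> A. h a = \<beta>} \<le> card Xs * card Ys"
      using fin by (metis card_cartesian_product card_mono finite_cartesian_product)
    have "card Xs \<le> t" "card Ys \<le> t"
      using card_mono[OF _ XsI] card_mono[OF _ YsI] by auto
    then have t2: "card Xs * card Ys \<le> t ^ 2" by (simp add: power2_eq_square mult_mono)
    show ?thesis
    proof (cases "\<beta> \<in> W \<or> prod.swap \<beta> \<in> W'")
      case True
      then show ?thesis using le t2 by auto
    next
      case False
      have "Xs = {y. y div t = p \<and> (\<exists>x. (x, y) \<in> prod.swap ` A \<and> x div t = q)}"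
        by (force simp: Xs_def)
      then have "card Xs \<le> s"
        using False pq by (auto simp: \<beta> W'_def wide_blocks_def)
      moreover have "card Ys \<le> s"
        using False pq by (auto simp: \<beta> W_def wide_blocks_def Ys_def)
      ultimately have "card Xs * card Ys \<le> s ^ 2" by (simp add: power2_eq_square mult_mono)
      then show ?thesis using le by auto
    qed
  qed
  have finB: "finite B" using finA by (simp add: B_def)
  have "card A = (\<Sum>\<beta>\<in>B. card {a \<in> A. h a = \<beta>})"
    unfolding B_def card_eq_sum using finA by (rule sum.image_gen)
  also have "\<dots> \<le> (\<Sum>\<beta>\<in>B. s ^ 2 + (if \<beta> \<in> W then t ^ 2 else 0) + (if prod.swap \<beta> \<in> W' then t ^ 2 else 0))"
    using blk by (rule sum_mono)
  also have "\<dots> = s ^ 2 * card B + t ^ 2 * card (B \<inter> W) + t ^ 2 * card {\<beta> \<in> B. prod.swap \<beta> \<in> W'}"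
    using finB by (simp add: sum.distrib sum.If_cases Int_def mult.commute)
  also have "\<dots> \<le> s ^ 2 * (D * N) + t ^ 2 * (N * F) + t ^ 2 * (N * F)"
  proof (intro add_mono mult_left_mono cardB)
    show "card (B \<inter> W) \<le> N * F" using card_mono[OF finW(1), of "B \<inter> W"] cardW by simp
    have "card {\<beta> \<in> B. prod.swap \<beta> \<in> W'} = card (prod.swap ` {\<beta> \<in> B. prod.swap \<beta> \<in> W'})"
      by (simp add: card_image)
    also have "\<dots> \<le> card W'" using finW(2) by (intro card_mono) auto
    finally show "card {\<beta> \<in> B. prod.swap \<beta> \<in> W'} \<le> N * F" using cardW' by simp
  qed auto
  also have "\<dots> = D * t ^ Suc j"
    by (simp add: t D_def N_def s4[symmetric] power2_eq_square algebra_simps)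
  finally show ?case by (simp add: D_def F_def mult.assoc)
qed

text \<open>Enlarging the side to the next power of \<open>t\<close> costs at most one factor
  \<open>t\<close>; the factor \<open>k\<close> is absorbed by \<open>k \<le> 2 ^ k\<close>.\<close>

lemma card_no_full_minor_le:
  assumes "k \<ge> 1" "n \<ge> 1" "\<not> full_minor k k A" "A \<subseteq> {..<n} \<times> {..<n}"
  shows "card A \<le> 2 ^ (9 * k + 6) * n"
proof -
  define t :: nat where "t = 2 ^ (2 * k + 1)"
  have t2: "t \<ge> 2" by (simp add: t_def)
  obtain j where j: "t ^ j \<le> n" "n < t ^ Suc j"
    using ex_power_ivl1[OF t2 assms(2)] by auto
  have "A \<subseteq> {..<t ^ Suc j} \<times> {..<t ^ Suc j}" using assms(4) j(2) by fastforce
  then have "card A \<le> 8 * 4 ^ k * k * 4 ^ (2 * k + 1) * t ^ Suc j"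
    using card_no_full_minor_power_le[OF assms(1,3), of "Suc j"] by (simp only: t_def)
  also have "\<dots> \<le> 8 * 4 ^ k * 2 ^ k * 4 ^ (2 * k + 1) * (t * n)"
    using j(1) less_exp[of k] by (intro mult_mono) auto
  also have "\<dots> = 2 ^ (3 + 2 * k + k + 2 * (2 * k + 1) + (2 * k + 1)) * n"
    by (simp add: t_def power_add power_mult flip: power_mult_distrib)
  also have "3 + 2 * k + k + 2 * (2 * k + 1) + (2 * k + 1) = 9 * k + 6" by simp
  finally show ?thesis .
qed

section \<open>Outputs of the greedy algorithms\<close>

text \<open>\<open>D b a\<close> says that \<open>b\<close> lies on the side of \<open>a\<close> on which stair keys are touched.\<close>

fun greedy_side :: "(nat \<Rightarrow> nat \<Rightarrow> bool) \<Rightarrow> point set \<Rightarrow> (nat \<Rightarrow> nat) \<Rightarrow> nat \<Rightarrow> point set" where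
  "greedy_side D I X 0 = {}"
| "greedy_side D I X (Suc t) =
     greedy_side D I X t \<union> {(X (Suc t), int (Suc t))} \<union>
     {(b, int (Suc t)) | b.
        b \<in> stair (I \<union> greedy_side D I X t) (int (Suc t)) (X (Suc t)) \<and> D b (X (Suc t))}"

lemma greedy_left_eq: "greedy_left I X n = greedy_side (<) I X n"
  by (induction n) auto

lemma greedy_right_eq: "greedy_right I X n = greedy_side (>) I X n"
  by (induction n) auto

lemma finite_greedy_side: "finite I \<Longrightarrow> finite (greedy_side D I X n)"
  by (induction n) (auto simp: finite_stair)

lemma greedy_side_time: "(b, s) \<in> greedy_side D I X n \<Longrightarrow> 1 \<le> s \<and> s \<le> int n"
  by (induction n) auto

lemma greedy_side_key:
  assumes "fst ` I \<subseteq> K" "\<And>t. t \<in> {1..n} \<Longrightarrow> X t \<in> K" "(b, s) \<in> greedy_side D I X n"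
  shows "b \<in> K"
  using assms(2,3)
proof (induction n arbitrary: b s)
  case (Suc n)
  have IH: "b \<in> K" if "(b, s) \<in> greedy_side D I X n" for b s
    using Suc.IH[of b s] Suc.prems(1) that by auto
  consider "(b, s) \<in> greedy_side D I X n" | "b = X (Suc n)"
    | "b \<in> stair (I \<union> greedy_side D I X n) (int (Suc n)) (X (Suc n))"
    using Suc.prems(2) by auto
  then show ?case
  proof cases
    case 3
    then obtain s' where "(b, s') \<in> I \<union> greedy_side D I X n"
      unfolding stair_def touched_def by blast
    then show ?thesis using IH assms(1) by force
  qed (use IH Suc.prems(1) in auto)
qed simp

text \<open>The descent moves the later point: if the access at time \<open>t\<close> misses the key
  interval, \<open>t\<close> is replaced by the preceding touch of \<open>y\<close>. The induction
  therefore leaves \<open>t\<close> free.\<close>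

lemma greedy_side_captures_access:
  assumes D: "D = (<) \<or> D = (>)"
    and I: "finite I" "\<And>b s. (b, s) \<in> I \<Longrightarrow> s \<le> 0"
    and "(x, s) \<in> greedy_side D I X n" "(y, t) \<in> greedy_side D I X n" "s < t" "D y x"
  shows "\<exists>t'\<in>{1..n}. s \<le> int t' \<and> int t' \<le> t \<and> X t' \<in> {min x y..max x y}"
  using assms(4-7)
proof (induction n arbitrary: t)
  case (Suc n t)
  define G where "G = greedy_side D I X n"
  define a where "a = X (Suc n)"
  have xs: "(x, s) \<in> G"
    using Suc.prems(1,2,3) greedy_side_time[OF Suc.prems(2)] by (auto simp: G_def)
  have s1: "1 \<le> s" "s \<le> int n" using greedy_side_time xs unfolding G_def by blast+
  show ?case
  proof (cases "(y, t) \<in> G")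
    case True
    with Suc.IH[of t] xs Suc.prems(3,4) show ?thesis by (force simp: G_def)
  next
    case False
    then have t: "t = int (Suc n)" and
      y: "y = a \<or> y \<in> stair (I \<union> G) (int (Suc n)) a \<and> D y a"
      using Suc.prems(2) by (auto simp: G_def a_def)
    show ?thesis
    proof (cases "a \<in> {min x y..max x y}")
      case True
      then show ?thesis using s1 t by (intro bexI[of _ "Suc n"]) (auto simp: a_def)
    next
      case ne: False
      then have st: "y \<in> stair (I \<union> G) (int (Suc n)) a" and Dya: "D y a" using y by auto
      \<comment> \<open>Both \<open>x\<close> and \<open>a\<close> lie on the same side of
        \<open>y\<close>, and \<open>a\<close> is outside the interval from \<open>x\<close> to
        \<open>y\<close>.\<close>
      have x_between: "x \<in> {min a y..max a y}" "x \<noteq> y"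
        using D Dya ne Suc.prems(4) by (auto simp: min_def max_def split: if_splits)
      define S where "S = {z. z \<le> int n \<and> (y, z) \<in> I \<union> G}"
      define \<tau> where "\<tau> = Max S"
      have tau_eq: "last_touch (I \<union> G) y (int (Suc n) - 1) = \<tau>"
        by (simp add: last_touch_def \<tau>_def S_def)
      have "finite (I \<union> G)" using I(1) by (simp add: G_def finite_greedy_side)
      then have "finite S"
        by (rule finite_subset[rotated, OF finite_imageI[of _ snd]]) (force simp: S_def)
      moreover have "S \<noteq> {}" using st by (auto simp: stair_def touched_def S_def)
      ultimately have "\<tau> \<in> S" unfolding \<tau>_def by (rule Max_in)
      then have \<tau>: "\<tau> \<le> int n" "(y, \<tau>) \<in> I \<union> G" by (auto simp: S_def)
      have "rect (a, int (Suc n)) (y, \<tau>) \<inter> (I \<union> G) \<subseteq> {(y, \<tau>)}"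
        using st tau_eq by (simp add: stair_def)
      then have "(x, s) \<notin> rect (a, int (Suc n)) (y, \<tau>)" using xs x_between(2) by auto
      \<comment> \<open>If \<open>\<tau> \<le> s\<close>, then \<open>(x, s)\<close> would lie in
        the rectangle of the stair.\<close>
      then have "s < \<tau>" using x_between(1) s1(2) by (auto simp: rect_def)
      \<comment> \<open>Points of \<open>I\<close> have times at most 0, below \<open>s\<close>. So
        this touch of \<open>y\<close> is an output point, as the induction hypothesis
        requires.\<close>
      moreover have "(y, \<tau>) \<in> G" using \<tau>(2) I(2)[of y \<tau>] \<open>s < \<tau>\<close> s1 by auto
      ultimately obtain t' where "t' \<in> {1..n}" "s \<le> int t'" "int t' \<le> \<tau>" "X t' \<in> {min x y..max x y}"
        using Suc.IH[of \<tau>] xs Suc.prems(4) unfolding G_def by blast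
      then show ?thesis using \<tau>(1) t by (intro bexI[of _ t']) auto
    qed
  qed
qed simp

text \<open>Point \<open>i\<close> of the pattern is captured by a pair of points in the blocks \<open>2 (\<pi> i)\<close>, \<open>2 (\<pi> i) + 1\<close>
  of keys and \<open>2 i\<close>, \<open>2 i + 1\<close> of times. As \<open>i\<close> and \<open>\<pi> i\<close> start at 1, two blocks stay unused.\<close>

lemma contains_pattern_if_full_minor:
  assumes D: "D = (<) \<or> D = (>)"
    and minor: "full_minor (2 * k + 2) (2 * k + 2) A"
    and capture: "\<And>x s y t. (x, s) \<in> A \<Longrightarrow> (y, t) \<in> A \<Longrightarrow> s < t \<Longrightarrow> D y x \<Longrightarrow>
      \<exists>t'\<in>{1..n}. t' \<in> {s..t} \<and> X t' \<in> {min x y..max x y}"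
    and \<pi>: "\<pi> permutes {1..k}"
  shows "contains_pattern n X k \<pi>"
proof -
  obtain u v where u: "mono u" and v: "mono v"
    and uv: "\<And>i j. i < 2 * k + 2 \<Longrightarrow> j < 2 * k + 2 \<Longrightarrow> \<exists>x y. (x, y) \<in> A \<and> u x = i \<and> v y = j"
    using full_minorE[OF minor] by blast
  have less_if_label: "x < y" if "mono w" "w x < w y" for w :: "nat \<Rightarrow> nat" and x y
    using that by (meson linorder_not_less monoD)
  have "\<exists>t'\<in>{1..n}. v t' div 2 = i \<and> u (X t') div 2 = \<pi> i" if i: "i \<in> {1..k}" for i
  proof -
    \<comment> \<open>Orients the pair: the later point \<open>y\<close> takes the lower key block
      for \<open>(<)\<close> and the upper one for \<open>(>)\<close>.\<close>
    define e :: nat where "e = (if D = (<) then 1 else 0)"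
    have "\<pi> i \<in> {1..k}" using permutes_in_image[OF \<pi>] i by blast
    then have lt: "2 * \<pi> i + e < 2 * k + 2" "2 * \<pi> i + (1 - e) < 2 * k + 2" "2 * i + 1 < 2 * k + 2"
      using i by (auto simp: e_def)
    obtain x s where p: "(x, s) \<in> A" "u x = 2 * \<pi> i + e" "v s = 2 * i"
      using uv[of "2 * \<pi> i + e" "2 * i"] lt by auto
    obtain y t where q: "(y, t) \<in> A" "u y = 2 * \<pi> i + (1 - e)" "v t = 2 * i + 1"
      using uv[of "2 * \<pi> i + (1 - e)" "2 * i + 1"] lt by auto
    have "s < t" using less_if_label[OF v, of s t] p q by simp
    moreover have "D y x"
    proof (cases "D = (<)")
      case True
      then show ?thesis using less_if_label[OF u, of y x] p q by (simp add: e_def)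
    next
      case False
      then show ?thesis using less_if_label[OF u, of x y] p q D by (auto simp: e_def)
    qed
    ultimately obtain t' where t': "t' \<in> {1..n}" "s \<le> t'" "t' \<le> t"
      "min x y \<le> X t'" "X t' \<le> max x y"
      using capture[OF p(1) q(1)] by auto
    have "v s \<le> v t'" "v t' \<le> v t" using t' v by (auto dest: monoD)
    moreover have "u (min x y) \<le> u (X t')" "u (X t') \<le> u (max x y)" using t' u by (auto dest: monoD)
    then have "2 * \<pi> i \<le> u (X t')" "u (X t') \<le> 2 * \<pi> i + 1"
      using p q by (auto simp: min_def max_def e_def split: if_splits)
    ultimately have "v t' div 2 = i" "u (X t') div 2 = \<pi> i" using p q by auto
    with t'(1) show ?thesis by blast
  qed
  then obtain f where f: "\<And>i. i \<in> {1..k} \<Longrightarrow> f i \<in> {1..n}"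
    "\<And>i. i \<in> {1..k} \<Longrightarrow> v (f i) div 2 = i" "\<And>i. i \<in> {1..k} \<Longrightarrow> u (X (f i)) div 2 = \<pi> i"
    by metis
  have mono2: "mono (\<lambda>x. w x div 2)" if "mono w" for w :: "nat \<Rightarrow> nat"
    using that by (simp add: mono_def div_le_mono)
  have X_less: "X (f i) < X (f j)" if "i \<in> {1..k}" "j \<in> {1..k}" "\<pi> i < \<pi> j" for i j
    by (rule less_if_label[OF mono2[OF u]]) (use that f in auto)
  show ?thesis
    unfolding contains_pattern_def
  proof (intro exI[of _ f] conjI ballI)
    show "strict_mono_on {1..k} f"
    proof (rule strict_mono_onI)
      fix i j assume "i \<in> {1..k}" "j \<in> {1..k}" "i < j"
      then show "f i < f j" using f(2) less_if_label[OF mono2[OF v], of "f i" "f j"] by simp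
    qed
    show "f ` {1..k} \<subseteq> {1..n}" using f(1) by auto
    fix i j assume ij: "i \<in> {1..k}" "j \<in> {1..k}"
    show "X (f i) < X (f j) \<longleftrightarrow> \<pi> i < \<pi> j"
    proof (cases "\<pi> i" "\<pi> j" rule: linorder_cases)
      case equal
      then have "i = j" using \<pi> by (metis permutes_inj injD)
      then show ?thesis by simp
    qed (use X_less ij in fastforce)+
  qed
qed

lemma card_greedy_side_le:
  assumes D: "D = (<) \<or> D = (>)"
    and I: "finite I" "\<And>b s. (b, s) \<in> I \<Longrightarrow> s \<le> 0" "fst ` I \<subseteq> {1..n}"
    and X: "X permutes {1..n}" and "n \<ge> 1"
    and \<pi>: "\<pi> permutes {1..k}" "avoids_pattern n X k \<pi>"
  shows "card (greedy_side D I X n) \<le> 2 ^ (18 * k + 25) * n"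
proof -
  define G where "G = greedy_side D I X n"
  define A where "A = map_prod id nat ` G"
  have time: "1 \<le> s \<and> s \<le> int n" if "(b, s) \<in> G" for b s
    using greedy_side_time that unfolding G_def by blast
  have key: "b \<in> {1..n}" if "(b, s) \<in> G" for b s
    using greedy_side_key[OF I(3), of n X b s D] that permutes_in_image[OF X] unfolding G_def by blast
  have "inj_on (map_prod id nat) G"
    using time by (fastforce simp: inj_on_def)
  then have "card G = card A" by (simp add: A_def card_image)
  \<comment> \<open>Keys and times run from 1 to \<open>n\<close> while matrix indices start at 0,
    hence side \<open>Suc n\<close>. Passing to \<open>2 * n\<close> raises the exponent by
    one.\<close>
  also have "\<dots> \<le> 2 ^ (9 * (2 * k + 2) + 6) * Suc n"
  proof (rule card_no_full_minor_le)
    show "A \<subseteq> {..<Suc n} \<times> {..<Suc n}"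
      using time key by (fastforce simp: A_def)
    show "\<not> full_minor (2 * k + 2) (2 * k + 2) A"
    proof
      assume minor: "full_minor (2 * k + 2) (2 * k + 2) A"
      have "contains_pattern n X k \<pi>"
      proof (rule contains_pattern_if_full_minor[OF D minor _ \<pi>(1)])
        fix x s y t assume "(x, s) \<in> A" "(y, t) \<in> A" "s < t" "D y x"
        moreover then have "(x, int s) \<in> G" "(y, int t) \<in> G" using time by (force simp: A_def)+
        ultimately show "\<exists>t'\<in>{1..n}. t' \<in> {s..t} \<and> X t' \<in> {min x y..max x y}"
          using greedy_side_captures_access[OF D I(1,2), where s = "int s" and t = "int t"]
          unfolding G_def by auto
      qed
      with \<pi>(2) show False by simp
    qed
  qed auto
  also have "\<dots> \<le> 2 ^ (9 * (2 * k + 2) + 6) * (2 * n)"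
    using \<open>n \<ge> 1\<close> by (intro mult_left_mono) auto
  also have "\<dots> = 2 ^ Suc (9 * (2 * k + 2) + 6) * n" by (simp only: power_Suc mult_ac)
  also have "Suc (9 * (2 * k + 2) + 6) = 18 * k + 25" by simp
  finally show ?thesis by (simp add: G_def)
qed

section \<open>Initial trees and the final constant\<close>

lemma initial_points_time: "(b, s) \<in> initial_points T \<Longrightarrow> s \<le> 0"
proof -
  have "key_depth t b \<ge> 1" if "b \<in> set_tree t" for t using that by (cases t) auto
  then show "(b, s) \<in> initial_points T \<Longrightarrow> s \<le> 0"
    by (force simp: initial_points_def tree_points_def split: option.splits)
qed

lemma initial_points_key:
  assumes "is_initial_tree n T"
  shows "fst ` initial_points T \<subseteq> {1..n}"
proof (cases T)
  case (Some t)
  have "fst ` tree_points t \<subseteq> set_tree t" by (auto simp: tree_points_def)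
  also have "set_tree t = {1..n}" using assms Some by (simp add: is_initial_tree_def)
  finally show ?thesis by (simp add: Some initial_points_def)
qed (simp add: initial_points_def)

lemma sgreedy_cost_le:
  assumes "X permutes {1..n}" "\<pi> permutes {1..k}" "avoids_pattern n X k \<pi>" "is_initial_tree n T"
  shows "sgreedy_cost T n X \<le> 2 ^ (18 * k + 26) * n"
proof (cases "n = 0")
  case True
  then show ?thesis by (simp add: sgreedy_cost_def sgreedy_def)
next
  case False
  let ?I = "initial_points T"
  have bound: "card (greedy_side D ?I X n) \<le> 2 ^ (18 * k + 25) * n" if "D = (<) \<or> D = (>)" for D
    by (rule card_greedy_side_le[OF that finite_initial_points initial_points_time
          initial_points_key[OF assms(4)] assms(1) _ assms(2,3)])
       (use False in auto)
  have "sgreedy_cost T n X \<le> card (greedy_side (<) ?I X n) + card (greedy_side (>) ?I X n)"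
    unfolding sgreedy_cost_def sgreedy_def greedy_left_eq greedy_right_eq by (rule card_Un_le)
  also have "\<dots> \<le> 2 ^ (18 * k + 25) * n + 2 ^ (18 * k + 25) * n"
    by (intro add_mono bound) auto
  also have "\<dots> = 2 ^ (18 * k + 26) * n" by (simp add: power_add)
  finally show ?thesis .
qed

theorem mainTheorem7:
  shows "\<exists>C::real. C > 0 \<and>
    (\<forall>(n::nat) (k::nat) (X :: nat \<Rightarrow> nat) (T :: nat tree option).
       X permutes {1..n} \<longrightarrow>
       (\<exists>\<pi>. \<pi> permutes {1..k} \<and> avoids_pattern n X k \<pi>) \<longrightarrow>
       is_initial_tree n T \<longrightarrow>
       real (sgreedy_cost T n X) \<le> real n * 2 powr (C * real k))"
proof (intro exI[of _ 44] conjI allI impI)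
  fix n k :: nat and X :: "nat \<Rightarrow> nat" and T :: "nat tree option"
  assume X: "X permutes {1..n}" and ex: "\<exists>\<pi>. \<pi> permutes {1..k} \<and> avoids_pattern n X k \<pi>"
    and T: "is_initial_tree n T"
  from ex obtain \<pi> where \<pi>: "\<pi> permutes {1..k}" "avoids_pattern n X k \<pi>" by blast
  have "contains_pattern n X 0 \<pi>" by (auto simp: contains_pattern_def monotone_on_def)
  \<comment> \<open>The empty pattern occurs in every sequence. With \<open>k \<ge> 1\<close> the
    additive constant in the exponent is absorbed: \<open>18 * k + 26 \<le> 44 * k\<close>.\<close>
  with \<pi>(2) have "k \<noteq> 0" by metis
  have "sgreedy_cost T n X \<le> 2 ^ (18 * k + 26) * n"
    by (rule sgreedy_cost_le[OF X \<pi> T])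
  also have "\<dots> \<le> 2 ^ (44 * k) * n"
    using \<open>k \<noteq> 0\<close> by (intro mult_right_mono power_increasing) auto
  finally have "real (sgreedy_cost T n X) \<le> real (2 ^ (44 * k) * n)" by (rule of_nat_mono)
  also have "\<dots> = real n * 2 powr (44 * real k)"
    by (simp add: powr_realpow[symmetric] mult.commute)
  finally show "real (sgreedy_cost T n X) \<le> real n * 2 powr (44 * real k)" .
qed simp

end
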